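(* Let $(X,d_X)$ be a metric space. The distance transforms $\mathsf{T},\mathcal{T}:C(S^1,X)\to C(\mathbf{F}_2(S^1),\mathbb{R})$ are continuous maps between function spaces. In particular, $\mathsf{T}$ is a $2$-Lipschitz map.
   Context: $\mathbf{F}_2(S^1)$ is the set of non-empty subsets $\{z_1,z_2\}\subset S^1$ of cardinality at most $2$, with the quotient topology from $S^1\times S^1$. For $\gamma\in C(S^1,X)$, $\mathsf{T}_\gamma(\{z_1,z_2\})=d_X(\gamma(z_1),\gamma(z_2))$ and $\mathcal{T}_\gamma=\tfrac12\mathsf{T}_\gamma^2$; $\mathsf{T}$ and $\mathcal{T}$ send $\gamma$ to $\mathsf{T}_\gamma$ and $\mathcal{T}_\gamma$. The function spaces carry the metrics $d(\gamma,\tilde\gamma)=\sup_{z\in S^1}d_X(\gamma(z),\tilde\gamma(z))$ on $C(S^1,X)$ and $d(f,\tilde f)=\sup_{w\in\mathbf{F}_2(S^1)}|f(w)-\tilde f(w)|$ on $C(\mathbf{F}_2(S^1),\mathbb{R})$. *)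

theory Defs
  imports "HOL-Analysis.Analysis"
begin

abbreviation S1 :: "complex topology" where
  "S1 \<equiv> top_of_set (sphere 0 1)"

definition F2 :: "'a topology \<Rightarrow> 'a set set" where
  "F2 X = {w. w \<subseteq> topspace X \<and> w \<noteq> {} \<and> finite w \<and> card w \<le> 2}"

definition F2_space :: "'a topology \<Rightarrow> 'a set topology" where
  "F2_space X = topology (\<lambda>U. U \<subseteq> F2 X \<and>
     openin (prod_topology X X) {p \<in> topspace (prod_topology X X). {fst p, snd p} \<in> U})"

lemma openin_F2_space:
  "openin (F2_space X) U \<longleftrightarrow> U \<subseteq> F2 X \<and>
     openin (prod_topology X X) {p \<in> topspace (prod_topology X X). {fst p, snd p} \<in> U}"
proof -
  let ?pre = "\<lambda>U. {p \<in> topspace (prod_topology X X). {fst p, snd p} \<in> U}"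
  have "istopology (\<lambda>U. U \<subseteq> F2 X \<and> openin (prod_topology X X) (?pre U))"
    unfolding istopology_def
  proof (intro conjI allI impI)
    fix S T
    assume "S \<subseteq> F2 X \<and> openin (prod_topology X X) (?pre S)"
      and "T \<subseteq> F2 X \<and> openin (prod_topology X X) (?pre T)"
    moreover have "?pre (S \<inter> T) = ?pre S \<inter> ?pre T" by auto
    ultimately show "S \<inter> T \<subseteq> F2 X" "openin (prod_topology X X) (?pre (S \<inter> T))"
      by (auto simp only: intro: openin_Int)
  next
    fix K
    assume K: "\<forall>k\<in>K. k \<subseteq> F2 X \<and> openin (prod_topology X X) (?pre k)"
    then show "\<Union>K \<subseteq> F2 X" by blast
    have "?pre (\<Union>K) = \<Union>(?pre ` K)" by auto
    with K show "openin (prod_topology X X) (?pre (\<Union>K))"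
      by (simp only:) (rule openin_Union, blast)
  qed
  then show ?thesis by (simp add: F2_space_def)
qed

lemma F2_iff: "w \<in> F2 X \<longleftrightarrow> (\<exists>x\<in>topspace X. \<exists>y\<in>topspace X. w = {x, y})"
proof
  assume w: "w \<in> F2 X"
  then have "card w = 1 \<or> card w = 2"
    unfolding F2_def by (auto simp: le_Suc_eq numeral_2_eq_2)
  then obtain x y where "w = {x, y}"
    by (metis card_1_singletonE card_2_iff insert_absorb2)
  with w show "\<exists>x\<in>topspace X. \<exists>y\<in>topspace X. w = {x, y}" by (auto simp: F2_def)
qed (auto simp: F2_def card_insert_if)

lemma topspace_F2_space [simp]: "topspace (F2_space X) = F2 X"
proof
  show "topspace (F2_space X) \<subseteq> F2 X"
    using openin_F2_space openin_topspace by blast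
  have "{p \<in> topspace (prod_topology X X). {fst p, snd p} \<in> F2 X} = topspace (prod_topology X X)"
    by (auto simp: F2_iff) blast
  then have "openin (F2_space X) (F2 X)"
    by (simp only: openin_F2_space openin_topspace subset_refl simp_thms)
  then show "F2 X \<subseteq> topspace (F2_space X)" by (rule openin_subset)
qed

lemma quotient_map_F2_space:
  "quotient_map (prod_topology X X) (F2_space X) (\<lambda>p. {fst p, snd p})"
  unfolding quotient_map_def
proof (intro conjI)
  show "(\<lambda>p. {fst p, snd p}) ` topspace (prod_topology X X) = topspace (F2_space X)"
    by (simp add: set_eq_iff F2_iff image_iff Bex_def)
qed (simp add: openin_F2_space)

text \<open>The library metric \<^const>\<open>cfunspace\<close> is the supremum metric on the bounded continuous
  functions. The two domains below are compact, so boundedness is automatic and these are the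
  spaces of all continuous functions. Functions are extensional, i.e. \<^const>\<open>undefined\<close>
  off the domain.\<close>

definition C_S1 :: "'x metric \<Rightarrow> (complex \<Rightarrow> 'x) metric" where
  "C_S1 m = cfunspace S1 m"

definition C_F2_S1 :: "(complex set \<Rightarrow> real) metric" where
  "C_F2_S1 = cfunspace (F2_space S1) euclidean_metric"

lemma mspace_C_S1:
  "mspace (C_S1 m) = {\<gamma> \<in> extensional (sphere 0 1). continuous_map S1 (mtopology_of m) \<gamma>}"
proof -
  have "compactin S1 (topspace S1)" by (simp add: compactin_subtopology)
  then show ?thesis
    unfolding C_S1_def
    by (subst compactin_mspace_cfunspace)
       (use continuous_map_funspace [of S1 "mtopology_of m"] in fastforce)+
qed

lemma mdist_C_S1:
  assumes "\<gamma> \<in> mspace (C_S1 m)" "\<gamma>' \<in> mspace (C_S1 m)"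
  shows "mdist (C_S1 m) \<gamma> \<gamma>' = (SUP z\<in>sphere 0 1. mdist m (\<gamma> z) (\<gamma>' z))"
proof -
  have "\<gamma> \<in> mspace (funspace (topspace S1) m)" "\<gamma>' \<in> mspace (funspace (topspace S1) m)"
    using assms cfunspace_subset_funspace unfolding C_S1_def by blast+
  then show ?thesis
    by (simp add: C_S1_def mdist_cfunspace_eq_mdist_funspace Metric_space.fdist_def)
qed

lemma compactin_F2_S1: "compactin (F2_space S1) (F2 S1)"
proof -
  have "compact_space S1" by (simp add: compact_space_subtopology)
  then have "compact_space (prod_topology S1 S1)" using compact_space_prod_topology by blast
  then have "compactin (prod_topology S1 S1) (topspace (prod_topology S1 S1))"
    by (simp only: compact_space_def)
  from image_compactin [OF this quotient_imp_continuous_map [OF quotient_map_F2_space]]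
  show ?thesis
    using quotient_imp_surjective_map [OF quotient_map_F2_space [of S1]]
    by (simp only: topspace_F2_space)
qed

lemma mspace_C_F2_S1:
  "mspace C_F2_S1 = {f \<in> extensional (F2 S1). continuous_map (F2_space S1) euclideanreal f}"
  using compactin_F2_S1
  unfolding C_F2_S1_def by (subst compactin_mspace_cfunspace) auto

lemma mdist_C_F2_S1:
  assumes "f \<in> mspace C_F2_S1" "g \<in> mspace C_F2_S1"
  shows "mdist C_F2_S1 f g = (SUP w\<in>F2 S1. \<bar>f w - g w\<bar>)"
proof -
  have "f \<in> mspace (funspace (topspace (F2_space S1)) euclidean_metric)"
       "g \<in> mspace (funspace (topspace (F2_space S1)) euclidean_metric)"
    using assms cfunspace_subset_funspace unfolding C_F2_S1_def by blast+
  moreover have "{1, 1} \<in> F2 S1" unfolding F2_iff by force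
  then have "F2 S1 \<noteq> {}" by blast
  ultimately show ?thesis
    using Metric_space_mspace_mdist [of "euclidean_metric :: real metric"]
    by (simp add: C_F2_S1_def mdist_cfunspace_eq_mdist_funspace Metric_space.fdist_def dist_real_def)
qed

text \<open>\<open>dist_transform\<close> is \<open>\<gamma> \<mapsto> T\<^sub>\<gamma>\<close>. The description is unique by symmetry of the distance;
  see \<open>dist_transform_pair\<close>.\<close>

definition dist_transform :: "'x metric \<Rightarrow> (complex \<Rightarrow> 'x) \<Rightarrow> complex set \<Rightarrow> real" where
  "dist_transform m \<gamma> = (\<lambda>w\<in>F2 S1. THE r. \<exists>z1 z2. w = {z1, z2} \<and> r = mdist m (\<gamma> z1) (\<gamma> z2))"

definition half_sq_dist_transform :: "'x metric \<Rightarrow> (complex \<Rightarrow> 'x) \<Rightarrow> complex set \<Rightarrow> real" where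
  "half_sq_dist_transform m \<gamma> = (\<lambda>w\<in>F2 S1. 1 / 2 * (dist_transform m \<gamma> w)\<^sup>2)"

lemma dist_transform_pair:
  assumes "z1 \<in> sphere 0 1" "z2 \<in> sphere 0 1"
  shows "dist_transform m \<gamma> {z1, z2} = mdist m (\<gamma> z1) (\<gamma> z2)"
proof -
  have "{z1, z2} \<in> F2 S1" using assms unfolding F2_iff by force
  moreover have "(THE r. \<exists>x y. {z1, z2} = {x, y} \<and> r = mdist m (\<gamma> x) (\<gamma> y)) = mdist m (\<gamma> z1) (\<gamma> z2)"
    by (rule the_equality) (auto simp: doubleton_eq_iff mdist_commute)
  ultimately show ?thesis by (simp add: dist_transform_def)
qed

end

theory Submission
  imports Defs
begin

text \<open>By the quadrilateral inequality (\<open>mdist_quadrilateral\<close>), moving both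
  endpoints of a pair changes their distance by at most the sum of the two displacements. If two
  loops are at sup distance d, each endpoint moves by at most d, so the values of the two distance
  transforms differ by at most 2d at every pair. This is the Lipschitz bound with constant 2, and
  continuity of \<open>dist_transform m\<close> follows.

  The other transform is the composite of \<open>dist_transform m\<close> with f \<mapsto> f^2/2, so
  it remains to see that this pointwise operation is continuous in the sup metric
  (\<open>continuous_map_half_square\<close>).\<close>

lemma mdist_quadrilateral:
  assumes "a \<in> mspace m" "b \<in> mspace m" "a' \<in> mspace m" "b' \<in> mspace m"
  shows "\<bar>mdist m a b - mdist m a' b'\<bar> \<le> mdist m a a' + mdist m b b'"
  \<comment> \<open>The path a, a', b', b bounds \<open>mdist m a b\<close> from above; the path a',
    a, b, b' does the same for \<open>mdist m a' b'\<close>.\<close>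
  using mdist_triangle [of a m a' b] mdist_triangle [of a' m b' b]
    mdist_triangle [of a' m a b'] mdist_triangle [of a m b b'] assms
  by (simp add: mdist_commute [of m a' a] mdist_commute [of m b' b])

lemma mdist_le_mdist_C_S1:
  assumes "\<gamma> \<in> mspace (C_S1 m)" "\<gamma>' \<in> mspace (C_S1 m)" "z \<in> sphere 0 1"
  shows "mdist m (\<gamma> z) (\<gamma>' z) \<le> mdist (C_S1 m) \<gamma> \<gamma>'"
  using mdist_cfunspace_imp_mdist_le [OF _ _ order_refl] assms
  unfolding C_S1_def by (metis topspace_euclidean_subtopology)

lemma abs_diff_le_mdist_C_F2_S1:
  assumes "f \<in> mspace C_F2_S1" "g \<in> mspace C_F2_S1" "w \<in> F2 S1"
  shows "\<bar>f w - g w\<bar> \<le> mdist C_F2_S1 f g"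
  using mdist_cfunspace_imp_mdist_le [OF _ _ order_refl] assms
  unfolding C_F2_S1_def by (metis topspace_F2_space mdist_euclidean_metric dist_real_def)

lemma mdist_C_F2_S1_le:
  assumes "0 \<le> B" "\<And>w. w \<in> F2 S1 \<Longrightarrow> \<bar>f w - g w\<bar> \<le> B"
  shows "mdist C_F2_S1 f g \<le> B"
  unfolding C_F2_S1_def using assms
  by (intro mdist_cfunspace_le) (auto simp: dist_real_def)

text \<open>Continuity on unordered pairs is checked on ordered pairs: the pullback along the
  quotient map is (x, y) \<mapsto> d(\<gamma>(x), \<gamma>(y)), which is continuous on the
  torus.\<close>

lemma dist_transform_in_C_F2_S1:
  assumes "\<gamma> \<in> mspace (C_S1 m)"
  shows "dist_transform m \<gamma> \<in> mspace C_F2_S1"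
proof -
  have \<gamma>: "continuous_map S1 (mtopology_of m) \<gamma>"
    using assms by (simp add: mspace_C_S1)
  have "continuous_map (prod_topology S1 S1) euclideanreal
          (\<lambda>p. mdist m ((\<gamma> \<circ> fst) p) ((\<gamma> \<circ> snd) p))"
    by (intro continuous_map_mdist continuous_map_compose [OF _ \<gamma>]
          continuous_map_fst continuous_map_snd)
  then have "continuous_map (prod_topology S1 S1) euclideanreal
          (dist_transform m \<gamma> \<circ> (\<lambda>p. {fst p, snd p}))"
    by (rule continuous_map_eq) (auto simp: dist_transform_pair)
  then have "continuous_map (F2_space S1) euclideanreal (dist_transform m \<gamma>)"
    by (rule continuous_compose_quotient_map [OF quotient_map_F2_space])
  then show ?thesis
    by (simp add: mspace_C_F2_S1 dist_transform_def)
qed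

lemma dist_transform_Lipschitz:
  assumes \<gamma>: "\<gamma> \<in> mspace (C_S1 m)" "\<gamma>' \<in> mspace (C_S1 m)"
  shows "mdist C_F2_S1 (dist_transform m \<gamma>) (dist_transform m \<gamma>') \<le> 2 * mdist (C_S1 m) \<gamma> \<gamma>'"
proof (rule mdist_C_F2_S1_le)
  fix w assume "w \<in> F2 S1"
  then obtain x y where xy: "x \<in> sphere 0 1" "y \<in> sphere 0 1" "w = {x, y}"
    unfolding F2_iff by auto
  have "\<gamma> \<in> sphere 0 1 \<rightarrow> mspace m" "\<gamma>' \<in> sphere 0 1 \<rightarrow> mspace m"
    using \<gamma> by (auto simp: C_S1_def)
  then have "\<bar>mdist m (\<gamma> x) (\<gamma> y) - mdist m (\<gamma>' x) (\<gamma>' y)\<bar>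
      \<le> mdist m (\<gamma> x) (\<gamma>' x) + mdist m (\<gamma> y) (\<gamma>' y)"
    using xy by (intro mdist_quadrilateral) blast+
  also have "\<dots> \<le> 2 * mdist (C_S1 m) \<gamma> \<gamma>'"
    using mdist_le_mdist_C_S1 [OF \<gamma> xy(1)] mdist_le_mdist_C_S1 [OF \<gamma> xy(2)] by simp
  finally show "\<bar>dist_transform m \<gamma> w - dist_transform m \<gamma>' w\<bar> \<le> 2 * mdist (C_S1 m) \<gamma> \<gamma>'"
    by (simp only: xy dist_transform_pair)
qed simp

text \<open>Squaring is Lipschitz on bounded sets, since f^2 - g^2 = (f - g)(f + g). The factor f +
  g is controlled near a given f because f is bounded, so \<delta> depends on f.\<close>

lemma continuous_map_half_square:
  "continuous_map (mtopology_of C_F2_S1) (mtopology_of C_F2_S1) (\<lambda>f. \<lambda>w\<in>F2 S1. 1 / 2 * (f w)\<^sup>2)"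
  (is "continuous_map _ _ ?Q")
  unfolding mtopology_of_def
    Metric_space.metric_continuous_map [OF Metric_space_mspace_mdist Metric_space_mspace_mdist]
proof (intro conjI ballI allI impI)
  show "?Q ` mspace C_F2_S1 \<subseteq> mspace C_F2_S1"
  proof (rule image_subsetI)
    fix f assume "f \<in> mspace C_F2_S1"
    then have "continuous_map (F2_space S1) euclideanreal (\<lambda>w. 1 / 2 * (f w)\<^sup>2)"
      by (intro continuous_map_real_mult continuous_map_real_pow) (auto simp: mspace_C_F2_S1)
    then have "continuous_map (F2_space S1) euclideanreal (?Q f)"
      by (rule continuous_map_eq) simp
    then show "?Q f \<in> mspace C_F2_S1"
      unfolding mspace_C_F2_S1 by blast
  qed
next
  fix f and \<epsilon> :: real assume f: "f \<in> mspace C_F2_S1" and "\<epsilon> > 0"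
  \<comment> \<open>The sup norm of f, expressed as its distance to the zero function.\<close>
  define M where "M = mdist C_F2_S1 f (\<lambda>w\<in>F2 S1. 0)"
  have "continuous_map (F2_space S1) euclideanreal (\<lambda>w\<in>F2 S1. 0)"
    by (rule continuous_map_eq [of _ _ "\<lambda>w. 0"]) auto
  then have "(\<lambda>w\<in>F2 S1. 0) \<in> mspace C_F2_S1"
    by (simp add: mspace_C_F2_S1)
  then have M: "\<bar>f w\<bar> \<le> M" if "w \<in> F2 S1" for w
    using abs_diff_le_mdist_C_F2_S1 [OF f _ that] that unfolding M_def by fastforce
  have "M \<ge> 0" by (simp add: M_def)
  show "\<exists>\<delta>>0. \<forall>g. g \<in> mspace C_F2_S1 \<and> mdist C_F2_S1 f g < \<delta> \<longrightarrow>
          mdist C_F2_S1 (?Q f) (?Q g) < \<epsilon>"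
  proof (intro exI conjI allI impI; (elim conjE)?)
    \<comment> \<open>The bound 1 keeps \<bar>g\<bar> at most M + 1; the other bound then brings the
      estimate \<open>mdist C_F2_S1 f g * (M + 1)\<close> below \<epsilon>.\<close>
    show "min 1 (\<epsilon> / (M + 1)) > 0" using \<open>\<epsilon> > 0\<close> \<open>M \<ge> 0\<close> by simp
    fix g assume g: "g \<in> mspace C_F2_S1" and d: "mdist C_F2_S1 f g < min 1 (\<epsilon> / (M + 1))"
    have "mdist C_F2_S1 (?Q f) (?Q g) \<le> mdist C_F2_S1 f g * (M + 1)"
    proof (rule mdist_C_F2_S1_le)
      fix w assume w: "w \<in> F2 S1"
      note fg = abs_diff_le_mdist_C_F2_S1 [OF f g w]
      have "\<bar>?Q f w - ?Q g w\<bar> = \<bar>f w - g w\<bar> * (\<bar>f w + g w\<bar> / 2)"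
        using w by (simp add: power2_eq_square square_diff_square_factored mult.commute
            flip: abs_mult diff_divide_distrib)
      \<comment> \<open>Here \<bar>f w + g w\<bar> \<le> 2 \<bar>f w\<bar> + \<bar>f w - g w\<bar>
        \<le> 2 M + 1, so half of it is at most M + 1.\<close>
      also have "\<dots> \<le> mdist C_F2_S1 f g * (M + 1)"
        using fg M [OF w] d by (intro mult_mono) auto
      finally show "\<bar>?Q f w - ?Q g w\<bar> \<le> mdist C_F2_S1 f g * (M + 1)" .
    qed (use \<open>M \<ge> 0\<close> in simp)
    also have "\<dots> < \<epsilon>"
      using d \<open>M \<ge> 0\<close> by (simp add: pos_less_divide_eq)
    finally show "mdist C_F2_S1 (?Q f) (?Q g) < \<epsilon>" .
  qed
qed

theorem lemma3p2:
  fixes m :: "'x metric"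
  shows "continuous_map (mtopology_of (C_S1 m)) (mtopology_of C_F2_S1) (dist_transform m) \<and>
         continuous_map (mtopology_of (C_S1 m)) (mtopology_of C_F2_S1) (half_sq_dist_transform m) \<and>
         (\<forall>\<gamma>\<in>mspace (C_S1 m). \<forall>\<gamma>'\<in>mspace (C_S1 m).
           mdist C_F2_S1 (dist_transform m \<gamma>) (dist_transform m \<gamma>') \<le> 2 * mdist (C_S1 m) \<gamma> \<gamma>')"
proof -
  have "Lipschitz_continuous_map (C_S1 m) C_F2_S1 (dist_transform m)"
    using dist_transform_in_C_F2_S1 dist_transform_Lipschitz
    unfolding Lipschitz_continuous_map_def by blast
  then have T: "continuous_map (mtopology_of (C_S1 m)) (mtopology_of C_F2_S1) (dist_transform m)"
    by (intro uniformly_continuous_imp_continuous_map Lipschitz_imp_uniformly_continuous_map)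
  have "half_sq_dist_transform m = (\<lambda>f. \<lambda>w\<in>F2 S1. 1 / 2 * (f w)\<^sup>2) \<circ> dist_transform m"
    by (simp add: fun_eq_iff half_sq_dist_transform_def)
  then have "continuous_map (mtopology_of (C_S1 m)) (mtopology_of C_F2_S1) (half_sq_dist_transform m)"
    using continuous_map_compose [OF T continuous_map_half_square] by simp
  with T show ?thesis
    using dist_transform_Lipschitz by blast
qed

end
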